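(* Let $A$ and $B$ be unital C*-algebras and let $T\colon A\to B$ be a unital surjective linear operator which preserves the numerical radius, i.e. $\nu(Tx)=\nu(x)$ for all $x\in A$. Then $T$ is a Jordan *-isomorphism.
   Context: For an element $x$ of a unital C*-algebra $A$, the numerical radius is $\nu(x)=\sup\{|\varphi(x)| : \varphi \text{ a state of } A\}$. A Jordan *-isomorphism is a bijective linear map $S$ with $S(x^* )=S(x)^*$ and $S(x\circ y)=Sx\circ Sy$ for all $x,y$, where $x\circ y=\tfrac12(xy+yx)$. *)

theory Defs
  imports "HOL-Analysis.Analysis"
begin

class cstar_algebra_1 = banach + real_normed_algebra_1 +
  fixes scaleC :: "complex \<Rightarrow> 'a \<Rightarrow> 'a"
    and cstar :: "'a \<Rightarrow> 'a"
  assumes scaleC_add_right: "scaleC c (x + y) = scaleC c x + scaleC c y"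
    and scaleC_add_left: "scaleC (c + d) x = scaleC c x + scaleC d x"
    and scaleC_scaleC: "scaleC c (scaleC d x) = scaleC (c * d) x"
    and scaleC_one: "scaleC 1 x = x"
    and scaleR_scaleC: "scaleR r x = scaleC (complex_of_real r) x"
    and norm_scaleC: "norm (scaleC c x) = cmod c * norm x"
    and mult_scaleC_left: "scaleC c x * y = scaleC c (x * y)"
    and mult_scaleC_right: "x * scaleC c y = scaleC c (x * y)"
    and cstar_cstar: "cstar (cstar x) = x"
    and cstar_add: "cstar (x + y) = cstar x + cstar y"
    and cstar_scaleC: "cstar (scaleC c x) = scaleC (cnj c) (cstar x)"
    and cstar_mult: "cstar (x * y) = cstar y * cstar x"
    and cstar_identity: "norm (cstar x * x) = (norm x)\<^sup>2"

definition clinear_map :: "('a::cstar_algebra_1 \<Rightarrow> 'b::cstar_algebra_1) \<Rightarrow> bool" where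
  "clinear_map T \<longleftrightarrow> (\<forall>x y. T (x + y) = T x + T y) \<and> (\<forall>c x. T (scaleC c x) = scaleC c (T x))"

definition cstate :: "('a::cstar_algebra_1 \<Rightarrow> complex) \<Rightarrow> bool" where
  "cstate \<phi> \<longleftrightarrow> (\<forall>x y. \<phi> (x + y) = \<phi> x + \<phi> y) \<and> (\<forall>c x. \<phi> (scaleC c x) = c * \<phi> x)
     \<and> (\<forall>x. Im (\<phi> (cstar x * x)) = 0 \<and> Re (\<phi> (cstar x * x)) \<ge> 0) \<and> \<phi> 1 = 1"

definition numerical_radius :: "'a::cstar_algebra_1 \<Rightarrow> real" where
  "numerical_radius x = Sup {cmod (\<phi> x) | \<phi>. cstate \<phi>}"

definition jordan_prod :: "'a::cstar_algebra_1 \<Rightarrow> 'a \<Rightarrow> 'a" where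
  "jordan_prod x y = scaleC (1/2) (x * y + y * x)"

definition jordan_star_iso :: "('a::cstar_algebra_1 \<Rightarrow> 'b::cstar_algebra_1) \<Rightarrow> bool" where
  "jordan_star_iso S \<longleftrightarrow> bij S \<and> clinear_map S \<and> (\<forall>x. S (cstar x) = cstar (S x))
     \<and> (\<forall>x y. S (jordan_prod x y) = jordan_prod (S x) (S y))"

end

theory Submission
  imports Defs
begin

text \<open>Positivity of a self-adjoint \<open>h\<close> is expressed by the norm condition \<open>\<parallel>t - h\<parallel> \<le> t\<close> for some
  \<open>t \<ge> 0\<close>, which visibly defines a convex cone; the binomial series for the square root, absolutely
  convergent on the closed unit ball, identifies it with the cone of squares of self-adjoint elements.
  Kaplansky's argument puts all \<open>x\<^sup>* x\<close> into the cone, so Hahn--Banach supplies enough states to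
  give \<open>\<nu>(h) = \<parallel>h\<parallel>\<close> for self-adjoint \<open>h\<close>.

  A unital map preserving \<open>\<nu>\<close> sends self-adjoint elements to self-adjoint ones, isometrically, and is
  therefore an order isomorphism. Kadison's inequality \<open>T(h)\<^sup>2 \<le> T(h\<^sup>2)\<close>, applied to \<open>T\<close> and to its
  inverse, gives \<open>T(h\<^sup>2) = T(h)\<^sup>2\<close>, and polarization does the rest.\<close>

subsection \<open>Involution, real and imaginary parts\<close>

lemma cstar_zero [simp]: "cstar 0 = (0::'a::cstar_algebra_1)"
  using cstar_add[of 0 "0::'a"] by simp

lemma cstar_scaleR [simp]: "cstar (r *\<^sub>R x) = r *\<^sub>R cstar (x::'a::cstar_algebra_1)"
  by (simp add: scaleR_scaleC cstar_scaleC)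

lemma cstar_minus [simp]: "cstar (- x) = - cstar (x::'a::cstar_algebra_1)"
  using cstar_scaleR[of "-1" x] by simp

lemma cstar_diff: "cstar (x - y) = cstar x - cstar (y::'a::cstar_algebra_1)"
  using cstar_add[of x "- y"] by simp

lemma cstar_one [simp]: "cstar 1 = (1::'a::cstar_algebra_1)"
  using cstar_mult[of 1 "cstar (1::'a)"] by (simp add: cstar_cstar)

text \<open>Submultiplicativity in the C*-identity bounds \<open>norm y\<close> by
  \<open>norm (cstar y)\<close>; applying this to \<open>cstar x\<close> too gives equality.\<close>

lemma norm_cstar [simp]: "norm (cstar x) = norm (x::'a::cstar_algebra_1)"
proof -
  have le: "norm y \<le> norm (cstar y)" for y :: 'a
  proof (cases "y = 0")
    case False
    have "norm y * norm y \<le> norm (cstar y) * norm y"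
      using norm_mult_ineq[of "cstar y" y] by (simp add: cstar_identity power2_eq_square)
    with False show ?thesis by simp
  qed simp
  show ?thesis using le[of x] le[of "cstar x"] by (simp add: cstar_cstar)
qed

lemma bounded_linear_cstar: "bounded_linear (cstar :: 'a::cstar_algebra_1 \<Rightarrow> 'a)"
  by (rule bounded_linear_intro[where K = 1]) (simp_all add: cstar_add)

lemma cstar_power: "cstar (x ^ n) = cstar (x::'a::cstar_algebra_1) ^ n"
  by (induction n) (simp_all add: cstar_mult power_commutes)

lemma scaleC_zero_right [simp]: "scaleC c 0 = (0::'a::cstar_algebra_1)"
  using scaleC_add_right[of c 0 "0::'a"] by simp

lemma scaleC_minus_right: "scaleC c (- x) = - scaleC c (x::'a::cstar_algebra_1)"
  using scaleC_add_right[of c x "- x"] by (simp add: eq_neg_iff_add_eq_0 add.commute)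

lemma scaleC_diff_right: "scaleC c (x - y) = scaleC c x - scaleC c (y::'a::cstar_algebra_1)"
  using scaleC_add_right[of c x "- y"] by (simp add: scaleC_minus_right)

lemma scaleC_i_i [simp]: "scaleC \<i> (scaleC \<i> x) = - (x::'a::cstar_algebra_1)"
proof -
  have "scaleC \<i> (scaleC \<i> x) = scaleC (complex_of_real (-1)) x"
    by (simp add: scaleC_scaleC)
  then show ?thesis by (simp add: scaleR_scaleC[symmetric] del: of_real_minus)
qed

lemma scaleC_minus_left: "scaleC (- c) x = - scaleC c (x::'a::cstar_algebra_1)"
proof -
  have "scaleC (- c) x = scaleC (complex_of_real (-1)) (scaleC c x)"
    by (simp add: scaleC_scaleC)
  then show ?thesis by (simp add: scaleR_scaleC[symmetric] del: of_real_minus)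
qed

lemma scaleC_eq: "scaleC c x = Re c *\<^sub>R x + Im c *\<^sub>R scaleC \<i> (x::'a::cstar_algebra_1)"
proof -
  have "scaleC c x = scaleC (complex_of_real (Re c) + complex_of_real (Im c) * \<i>) x"
    by (metis complex_eq mult.commute)
  then show ?thesis
    by (simp only: scaleC_add_left scaleC_scaleC[symmetric] scaleR_scaleC)
qed

lemma scaleC_scaleR: "scaleC c (r *\<^sub>R x) = r *\<^sub>R scaleC c (x::'a::cstar_algebra_1)"
  by (simp add: scaleR_scaleC scaleC_scaleC mult.commute)

definition cre :: "'a::cstar_algebra_1 \<Rightarrow> 'a" where
  "cre x = (1/2) *\<^sub>R (x + cstar x)"

definition cim :: "'a::cstar_algebra_1 \<Rightarrow> 'a" where
  "cim x = (1/2) *\<^sub>R scaleC \<i> (cstar x - x)"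

lemma cstar_cre [simp]: "cstar (cre x) = cre x"
  by (simp add: cre_def cstar_add cstar_cstar add.commute)

lemma cstar_cim [simp]: "cstar (cim x) = cim x"
  by (simp add: cim_def cstar_diff cstar_cstar cstar_scaleC scaleC_minus_left scaleC_diff_right)

lemma cre_cim: "cre x + scaleC \<i> (cim x) = x"
proof -
  have "cre x + scaleC \<i> (cim x) = (1/2) *\<^sub>R (x + cstar x) + (1/2) *\<^sub>R (x - cstar x)"
    by (simp add: cre_def cim_def scaleC_scaleR)
  also have "\<dots> = x" by (simp add: algebra_simps flip: scaleR_add_left)
  finally show ?thesis .
qed

lemma norm_square_selfadjoint: "cstar h = h \<Longrightarrow> norm (h * h) = (norm (h::'a::cstar_algebra_1))\<^sup>2"
  using cstar_identity[of h] by simp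

text \<open>By commutativity \<open>w = h + i k\<close> satisfies \<open>cstar w * w = c\<close>, so
  \<open>norm w\<close> squared is |c|, and \<open>h\<close> is the real part of \<open>w\<close>.
  This takes the place of functional calculus when a root is to be bounded.\<close>

lemma norm_le_of_sum_squares:
  fixes h k :: "'a::cstar_algebra_1"
  assumes sa: "cstar h = h" "cstar k = k" and comm: "h * k = k * h"
    and eq: "h * h + k * k = c *\<^sub>R 1"
  shows "(norm h)\<^sup>2 \<le> \<bar>c\<bar>"
proof -
  define w where "w = h + scaleC \<i> k"
  have ws: "cstar w = h - scaleC \<i> k"
    by (simp add: w_def cstar_add cstar_scaleC sa scaleC_minus_left)
  have "cstar w * w = c *\<^sub>R 1"
    using eq comm by (simp add: ws) (simp add: w_def algebra_simps mult_scaleC_left mult_scaleC_right scaleC_add_right scaleC_diff_right)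
  then have nw: "(norm w)\<^sup>2 = \<bar>c\<bar>"
    using cstar_identity[of w] by simp
  have "h = (1/2) *\<^sub>R (w + cstar w)"
    by (simp add: ws) (simp add: w_def flip: scaleR_2)
  then have "norm h = (1/2) * norm (w + cstar w)"
    by (metis abs_of_pos half_gt_zero_iff norm_scaleR zero_less_one)
  also have "\<dots> \<le> norm w"
    using norm_triangle_ineq[of w "cstar w"] by simp
  finally show ?thesis using nw by (metis norm_ge_zero power_mono)
qed

subsection \<open>Square roots by the binomial series\<close>

text \<open>Taylor coefficients of sqrt(1 - z) at 0.\<close>

definition sqrt_coeff :: "nat \<Rightarrow> real" where
  "sqrt_coeff n = (-1) ^ n * ((1/2) gchoose n)"

lemma sqrt_coeff_0: "sqrt_coeff 0 = 1"
  by (simp add: sqrt_coeff_def)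

text \<open>In Pochhammer form only the first factor, -1/2, is negative.\<close>

lemma sqrt_coeff_Suc: "sqrt_coeff (Suc n) \<le> 0"
proof -
  have "sqrt_coeff (Suc n) = pochhammer (-1/2) (Suc n) / fact (Suc n)"
    unfolding sqrt_coeff_def gbinomial_pochhammer
    by (simp flip: power_mult_distrib mult.assoc)
  also have "pochhammer (-1/2) (Suc n) = (-1/2) * pochhammer (1/2::real) n"
    by (simp add: pochhammer_rec)
  finally show ?thesis
    using pochhammer_nonneg[of "1/2::real" n] by (simp add: divide_nonpos_pos mult_nonpos_nonneg)
qed

text \<open>The alternating sum of binomials of 1/2 collapses to a single binomial of -1/2, whose
  Pochhammer form has only positive factors.\<close>

lemma sum_sqrt_coeff_nonneg: "(\<Sum>k\<le>n. sqrt_coeff k) \<ge> 0"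
proof -
  have "(\<Sum>k\<le>n. sqrt_coeff k) = (\<Sum>k\<le>n. ((1/2::real) gchoose k) * (-1) ^ k)"
    by (simp add: sqrt_coeff_def mult.commute)
  also have "\<dots> = (-1) ^ n * ((1/2 - 1::real) gchoose n)"
    by (rule gbinomial_sum_lower_neg)
  also have "\<dots> = pochhammer (1/2) n / fact n"
    unfolding gbinomial_pochhammer by (simp flip: power_mult_distrib mult.assoc)
  finally show ?thesis using pochhammer_nonneg[of "1/2::real" n] by simp
qed

text \<open>By Vandermonde's identity these are the coefficients of 1 - z, the square of the
  series.\<close>

lemma sqrt_coeff_convolution:
  "(\<Sum>i\<le>n. sqrt_coeff i * sqrt_coeff (n - i)) = (if n = 0 then 1 else if n = 1 then - 1 else 0)"
proof -
  have "(\<Sum>i\<le>n. sqrt_coeff i * sqrt_coeff (n - i))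
      = (\<Sum>i\<le>n. (-1) ^ n * (((1/2::real) gchoose i) * ((1/2) gchoose (n - i))))"
    by (rule sum.cong) (auto simp: sqrt_coeff_def simp flip: power_add)
  also have "\<dots> = (-1) ^ n * ((1/2 + 1/2 :: real) gchoose n)"
    by (simp only: sum_distrib_left[symmetric] gbinomial_Vandermonde[of "1/2" "1/2::real" n, symmetric] atLeast0AtMost)
  also have "\<dots> = (-1) ^ n * real (1 choose n)"
    using binomial_gbinomial[of 1 n, where ?'a = real] by simp
  finally show ?thesis by (cases n) (auto simp: binomial_eq_0)
qed

text \<open>All coefficients after the leading 1 are nonpositive, so this sum is 1 minus a
  nonnegative partial sum. It gives absolute convergence up to radius 1.\<close>

lemma sum_abs_sqrt_coeff: "(\<Sum>k<n. \<bar>sqrt_coeff (Suc k)\<bar>) \<le> 1"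
proof -
  have "(\<Sum>k<n. \<bar>sqrt_coeff (Suc k)\<bar>) = - (\<Sum>k<n. sqrt_coeff (Suc k))"
    by (simp add: abs_of_nonpos sqrt_coeff_Suc sum_negf)
  moreover have "(\<Sum>k\<le>n. sqrt_coeff k) = 1 + (\<Sum>k<n. sqrt_coeff (Suc k))"
    unfolding lessThan_Suc_atMost[symmetric] sum.lessThan_Suc_shift by (simp add: sqrt_coeff_0)
  ultimately show ?thesis using sum_sqrt_coeff_nonneg[of n] by simp
qed

lemma summable_abs_sqrt_coeff_Suc: "summable (\<lambda>n. \<bar>sqrt_coeff (Suc n)\<bar>)"
  by (rule bounded_imp_summable[where B = 1])
     (use sum_abs_sqrt_coeff in \<open>auto simp flip: lessThan_Suc_atMost simp del: sum.lessThan_Suc\<close>)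

text \<open>The series of sqrt(1 - z) is evaluated at \<open>u\<close>. The bound on
  \<open>1 - k\<close> will say that \<open>k\<close> is positive; commutation passes from powers of
  \<open>u\<close> to the limit and later supplies commuting roots.\<close>

lemma sqrt_one_minus:
  fixes u :: "'a::cstar_algebra_1"
  assumes sa: "cstar u = u" and u: "norm u \<le> 1"
  obtains k where "cstar k = k" "norm (1 - k) \<le> 1" "k * k = 1 - u"
    "\<And>w. w * u = u * w \<Longrightarrow> w * k = k * w"
proof -
  define f where "f n = sqrt_coeff n *\<^sub>R u ^ n" for n
  have nf: "norm (f n) \<le> \<bar>sqrt_coeff n\<bar>" for n
    using u by (simp add: f_def)
      (meson abs_ge_zero mult_left_le norm_ge_zero norm_power_ineq order_trans power_le_one)
  have sumS: "summable (\<lambda>n. norm (f (Suc n)))"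
    by (rule summable_comparison_test'[OF summable_abs_sqrt_coeff_Suc, where N = 0])
       (use nf in simp)
  then have sumn: "summable (\<lambda>n. norm (f n))"
    by (rule summable_Suc_iff[THEN iffD1])
  then have sumf: "summable f" by (rule summable_norm_cancel)
  define k where "k = suminf f"
  have k_sums: "f sums k" unfolding k_def using sumf by (rule summable_sums)
  have 1: "cstar k = k"
  proof -
    have "(\<lambda>n. cstar (f n)) sums cstar k"
      by (rule bounded_linear.sums[OF bounded_linear_cstar k_sums])
    moreover have "cstar (f n) = f n" for n by (simp add: f_def cstar_power sa)
    ultimately have "f sums cstar k" by simp
    then show ?thesis using k_sums sums_unique2 by blast
  qed
  have 2: "norm (1 - k) \<le> 1"
  proof -
    have "k = (\<Sum>n. f (Suc n)) + f 0"
      unfolding k_def by (rule suminf_split_head[THEN eq_diff_eq[THEN iffD1], OF sumf, symmetric])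
    then have "norm (1 - k) = norm (\<Sum>n. f (Suc n))"
      by (simp add: f_def sqrt_coeff_0)
    also have "\<dots> \<le> (\<Sum>n. norm (f (Suc n)))" by (rule summable_norm[OF sumS])
    also have "\<dots> \<le> (\<Sum>n. \<bar>sqrt_coeff (Suc n)\<bar>)"
      by (rule suminf_le[OF nf sumS summable_abs_sqrt_coeff_Suc])
    also have "\<dots> \<le> 1"
      by (rule suminf_le_const[OF summable_abs_sqrt_coeff_Suc sum_abs_sqrt_coeff])
    finally show ?thesis .
  qed
  have 3: "k * k = 1 - u"
  proof -
    have "(\<lambda>n. \<Sum>i\<le>n. f i * f (n - i)) sums (k * k)"
      unfolding k_def by (rule Cauchy_product_sums[OF sumn sumn])
    moreover have "(\<Sum>i\<le>n. f i * f (n - i)) = (if n = 0 then 1 else if n = 1 then - u else 0)" for n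
    proof -
      have "(\<Sum>i\<le>n. f i * f (n - i)) = (\<Sum>i\<le>n. (sqrt_coeff i * sqrt_coeff (n - i)) *\<^sub>R u ^ n)"
        by (rule sum.cong) (auto simp: f_def mult.commute simp flip: power_add)
      also have "\<dots> = (\<Sum>i\<le>n. sqrt_coeff i * sqrt_coeff (n - i)) *\<^sub>R u ^ n"
        by (simp add: scaleR_left.sum)
      finally show ?thesis by (simp add: sqrt_coeff_convolution)
    qed
    ultimately have a: "(\<lambda>n. if n = 0 then 1 else if n = 1 then - u else 0) sums (k * k)" by simp
    have "(\<lambda>n. if n = 0 then 1 else if n = 1 then - u else 0) sums (1 - u)"
      using sums_finite[of "{0,1::nat}" "\<lambda>n. if n = 0 then 1 else if n = 1 then - u else 0"] by simp
    with a show ?thesis using sums_unique2 by blast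
  qed
  have 4: "w * k = k * w" if w: "w * u = u * w" for w
  proof -
    have "w * u ^ n = u ^ n * w" for n
      using power_commuting_commutes[of u w n] w by simp
    then have "(\<lambda>n. w * f n) = (\<lambda>n. f n * w)" by (simp add: f_def)
    then show ?thesis
      using sums_mult[OF k_sums, of w] sums_mult2[OF k_sums, of w] sums_unique2 by metis
  qed
  show ?thesis using that 1 2 3 4 by blast
qed

subsection \<open>The positive cone\<close>

definition pos :: "'a::cstar_algebra_1 \<Rightarrow> bool" where
  "pos h \<longleftrightarrow> cstar h = h \<and> (\<exists>t\<ge>0. norm (t *\<^sub>R 1 - h) \<le> t)"

lemma posI: "cstar h = h \<Longrightarrow> norm (t *\<^sub>R 1 - h) \<le> t \<Longrightarrow> pos h"
  unfolding pos_def by (meson norm_ge_zero order_trans)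

lemma pos_selfadjoint: "pos h \<Longrightarrow> cstar h = h"
  by (simp add: pos_def)

lemma pos_add:
  assumes "pos h" "pos k" shows "pos (h + k)"
proof -
  obtain s t where st: "norm (s *\<^sub>R 1 - h) \<le> s" "norm (t *\<^sub>R 1 - k) \<le> t"
    using assms unfolding pos_def by metis
  have "(s + t) *\<^sub>R 1 - (h + k) = (s *\<^sub>R 1 - h) + (t *\<^sub>R 1 - k)" by (simp add: algebra_simps)
  then have "norm ((s + t) *\<^sub>R 1 - (h + k)) \<le> s + t"
    using st norm_triangle_ineq[of "s *\<^sub>R 1 - h" "t *\<^sub>R 1 - k"]
    by (metis add_mono order_trans)
  then show ?thesis by (rule posI[rotated]) (use assms in \<open>simp add: cstar_add pos_def\<close>)
qed

lemma pos_scaleR: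
  assumes "pos h" "r \<ge> 0" shows "pos (r *\<^sub>R h)"
proof -
  obtain s where s: "norm (s *\<^sub>R 1 - h) \<le> s"
    using assms pos_def by blast
  have "(r * s) *\<^sub>R 1 - r *\<^sub>R h = r *\<^sub>R (s *\<^sub>R 1 - h)" by (simp add: algebra_simps)
  then have "norm ((r * s) *\<^sub>R 1 - r *\<^sub>R h) \<le> r * s"
    using s assms(2) by (simp add: mult_left_mono)
  then show ?thesis by (rule posI[rotated]) (use assms in \<open>simp add: pos_def\<close>)
qed

lemma pos_diff_of_norm_le: "cstar h = h \<Longrightarrow> norm h \<le> t \<Longrightarrow> pos (t *\<^sub>R 1 - h)"
  by (rule posI[of _ t]) (simp_all add: cstar_diff)

lemma pos_zero [simp]: "pos 0"
  by (rule posI[of _ 0]) simp_all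

lemma pos_one [simp]: "pos 1"
  by (rule posI[of _ 1]) simp_all

lemma pos_scaleR_one_iff [simp]: "pos (r *\<^sub>R (1::'a::cstar_algebra_1)) \<longleftrightarrow> r \<ge> 0"
proof
  assume "pos (r *\<^sub>R (1::'a))"
  then obtain t where t: "norm (t *\<^sub>R 1 - r *\<^sub>R (1::'a)) \<le> t" using pos_def by blast
  have "norm (t *\<^sub>R 1 - r *\<^sub>R (1::'a)) = \<bar>t - r\<bar>" by (simp flip: scaleR_diff_left)
  with t show "r \<ge> 0" by simp
qed (simp add: pos_scaleR)

text \<open>Division by \<open>t\<close> turns the norm condition into \<open>norm u \<le> 1\<close>
  for \<open>u = 1 - h/t\<close>, where the series applies.\<close>

lemma pos_sqrt:
  assumes "pos h"
  obtains k where "pos k" "k * k = h" "\<And>w. w * h = h * w \<Longrightarrow> w * k = k * w"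
proof -
  obtain t where t: "t \<ge> 0" "norm (t *\<^sub>R 1 - h) \<le> t" using assms pos_def by blast
  show ?thesis
  proof (cases "t = 0")
    case True
    then have "h = 0" using t by simp
    then show ?thesis using that[of 0] by simp
  next
    case False
    with t have t0: "t > 0" by simp
    define u where "u = 1 - (1/t) *\<^sub>R h"
    have "u = (1/t) *\<^sub>R (t *\<^sub>R 1 - h)" using t0 by (simp add: u_def algebra_simps)
    then have "norm u = norm (t *\<^sub>R 1 - h) / t" using t0 by simp
    then have nu: "norm u \<le> 1" using t t0 by (simp add: divide_le_eq_1)
    have sa: "cstar u = u" using pos_selfadjoint[OF assms] by (simp add: u_def cstar_diff)
    obtain k where k: "cstar k = k" "norm (1 - k) \<le> 1" "k * k = 1 - u"
      "\<And>w. w * u = u * w \<Longrightarrow> w * k = k * w" using sqrt_one_minus[OF sa nu] by metis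
    show ?thesis
    proof (rule that)
      have "pos k" by (rule posI[of _ 1]) (use k(1,2) in auto)
      then show "pos (sqrt t *\<^sub>R k)" using t0 by (simp add: pos_scaleR)
      show "(sqrt t *\<^sub>R k) * (sqrt t *\<^sub>R k) = h" using t0 by (simp add: k(3) u_def)
      show "w * (sqrt t *\<^sub>R k) = (sqrt t *\<^sub>R k) * w" if "w * h = h * w" for w
        using k(4)[of w] that by (simp add: u_def algebra_simps)
    qed
  qed
qed

text \<open>With \<open>s = norm k\<close>, the element s^2 - k^2 has a root \<open>m\<close>
  commuting with \<open>k\<close>. Then m^2 + k^2 = s^2 bounds \<open>norm m\<close> by
  \<open>s\<close>, which is the norm condition for k^2 with scalar s^2.\<close>

lemma pos_square:
  fixes k :: "'a::cstar_algebra_1"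
  assumes sa: "cstar k = k" shows "pos (k * k)"
proof -
  define s where "s = norm k"
  have sa2: "cstar (k * k) = k * k" by (simp add: cstar_mult sa)
  have "pos (s\<^sup>2 *\<^sub>R 1 - k * k)"
    by (rule pos_diff_of_norm_le[OF sa2]) (simp add: s_def norm_square_selfadjoint sa)
  then obtain m where m: "pos m" "m * m = s\<^sup>2 *\<^sub>R 1 - k * k"
    "\<And>w. w * (s\<^sup>2 *\<^sub>R 1 - k * k) = (s\<^sup>2 *\<^sub>R 1 - k * k) * w \<Longrightarrow> w * m = m * w"
    by (rule pos_sqrt) blast
  have "k * m = m * k" by (rule m(3)) (simp add: algebra_simps)
  then have "(norm m)\<^sup>2 \<le> \<bar>s\<^sup>2\<bar>"
    using norm_le_of_sum_squares[of m k] m(2) sa pos_selfadjoint[OF m(1)] by simp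
  then show ?thesis
    using posI[OF sa2, of "s\<^sup>2"] norm_square_selfadjoint[OF pos_selfadjoint[OF m(1)]] m(2) by simp
qed

text \<open>The roots \<open>a\<close> and \<open>b\<close> commute, so the product is the square of
  the self-adjoint \<open>a * b\<close>.\<close>

lemma pos_mult:
  assumes "pos h" "pos k" "h * k = k * h" shows "pos (h * k)"
proof -
  obtain a where a: "pos a" "a * a = h" "\<And>w. w * h = h * w \<Longrightarrow> w * a = a * w"
    using pos_sqrt[OF assms(1)] by metis
  obtain b where b: "pos b" "b * b = k" "\<And>w. w * k = k * w \<Longrightarrow> w * b = b * w"
    using pos_sqrt[OF assms(2)] by metis
  have ab: "a * b = b * a" using a(3)[of k] b(3)[of a] assms(3) by simp
  have "(a * b) * (a * b) = a * (b * a) * b" by (simp add: mult.assoc)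
  also have "\<dots> = h * k" by (simp add: a(2)[symmetric] b(2)[symmetric] ab[symmetric] mult.assoc)
  finally show ?thesis
    using pos_square[of "a * b"] a(1) b(1) ab by (simp add: cstar_mult pos_selfadjoint)
qed

text \<open>The roots of \<open>a\<close> and of \<open>c - a\<close> commute and their squares add
  up to the scalar \<open>c\<close>.\<close>

lemma norm_le_of_pos:
  assumes "pos a" "pos (c *\<^sub>R 1 - a)" shows "norm a \<le> c"
proof -
  have c: "c \<ge> 0" using pos_add[OF assms] by simp
  obtain k where k: "pos k" "k * k = a" using pos_sqrt[OF assms(1)] by metis
  obtain m where m: "pos m" "m * m = c *\<^sub>R 1 - a"
    "\<And>w. w * (c *\<^sub>R 1 - a) = (c *\<^sub>R 1 - a) * w \<Longrightarrow> w * m = m * w"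
    using pos_sqrt[OF assms(2)] by metis
  have "k * m = m * k" by (rule m(3)) (simp add: algebra_simps flip: k(2))
  then have "(norm k)\<^sup>2 \<le> \<bar>c\<bar>"
    using norm_le_of_sum_squares[of k m c] m(1,2) k by (simp add: pos_selfadjoint)
  then show ?thesis
    using norm_square_selfadjoint[OF pos_selfadjoint[OF k(1)]] k(2) c by simp
qed

text \<open>The two positive elements commute, and their product is s^2 - h^2; this bounds the norm
  of h^2.\<close>

lemma norm_le_of_pos_diff_add:
  assumes "pos (s *\<^sub>R 1 - h)" "pos (s *\<^sub>R 1 + h)" shows "norm h \<le> s"
proof -
  have s: "s \<ge> 0"
    using pos_add[OF assms] by (simp flip: scaleR_add_left)
  have sa: "cstar h = h"
    using pos_selfadjoint[OF assms(2)] by (simp add: cstar_add)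
  have "pos ((s *\<^sub>R 1 - h) * (s *\<^sub>R 1 + h))"
    by (rule pos_mult[OF assms]) (simp add: algebra_simps)
  also have "(s *\<^sub>R 1 - h) * (s *\<^sub>R 1 + h) = s\<^sup>2 *\<^sub>R 1 - h * h"
    by (simp add: algebra_simps power2_eq_square)
  finally have "norm (h * h) \<le> s\<^sup>2" by (rule norm_le_of_pos[OF pos_square[OF sa]])
  then show ?thesis using norm_square_selfadjoint[OF sa] s by (simp add: power2_le_iff_abs_le)
qed

lemma norm_add_scalar_ge:
  assumes "pos a" shows "norm a + s \<le> norm (a + s *\<^sub>R 1)"
proof -
  have "pos (norm (a + s *\<^sub>R 1) *\<^sub>R 1 - (a + s *\<^sub>R 1))"
    by (rule pos_diff_of_norm_le) (simp_all add: cstar_add pos_selfadjoint[OF assms])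
  then have "pos ((norm (a + s *\<^sub>R 1) - s) *\<^sub>R 1 - a)" by (simp add: algebra_simps)
  from norm_le_of_pos[OF assms this] show ?thesis by simp
qed

text \<open>One scalar \<open>t\<close> serves for all \<open>e\<close>: from 0 <= t - h <= t + e
  follows \<open>norm (t - h) \<le> t + e\<close>, and \<open>e\<close> may tend to 0.\<close>

lemma pos_closed:
  fixes h :: "'a::cstar_algebra_1"
  assumes "\<And>e. e > 0 \<Longrightarrow> pos (h + e *\<^sub>R 1)" shows "pos h"
proof -
  have sa: "cstar h = h" using pos_selfadjoint[OF assms[of 1]] by (simp add: cstar_add)
  define t where "t = norm h + 1"
  have "norm (t *\<^sub>R 1 - h) \<le> t + e" if "e > 0" for e
  proof -
    have "pos ((t + e) *\<^sub>R 1 - (h + e *\<^sub>R 1))"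
      using pos_diff_of_norm_le[OF sa, of t] by (simp add: t_def algebra_simps)
    then have 1: "pos (t *\<^sub>R 1 - h)" by (simp add: algebra_simps)
    have "pos ((t + e) *\<^sub>R 1 - (t *\<^sub>R 1 - h))" using assms[OF that] by (simp add: algebra_simps)
    with 1 show ?thesis by (rule norm_le_of_pos)
  qed
  then have "norm (t *\<^sub>R 1 - h) \<le> t" by (rule field_le_epsilon)
  then show ?thesis by (rule posI[OF sa])
qed

text \<open>Complete the square: p^2 + t p = (p + t/2)^2 - t^2/4, and adding t/2 to a positive
  element raises its norm by at least t/2.\<close>

lemma norm_shifted_square_ge:
  fixes p :: "'a::cstar_algebra_1"
  assumes "pos p" "t \<ge> 0"
  shows "(norm p)\<^sup>2 + t * norm p \<le> norm (p * p + t *\<^sub>R p)"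
proof -
  define P where "P = p + (t/2) *\<^sub>R 1"
  have sa: "cstar P = P" using pos_selfadjoint[OF assms(1)] by (simp add: P_def cstar_add)
  have "P * P = (p * p + t *\<^sub>R p) + (t\<^sup>2/4) *\<^sub>R 1"
    by (simp add: P_def algebra_simps power2_eq_square flip: scaleR_add_left)
  then have "norm (P * P) \<le> norm (p * p + t *\<^sub>R p) + t\<^sup>2/4"
    using norm_triangle_ineq[of "p * p + t *\<^sub>R p" "(t\<^sup>2/4) *\<^sub>R 1"] by simp
  moreover have "(norm p + t/2)\<^sup>2 \<le> norm (P * P)"
    unfolding norm_square_selfadjoint[OF sa]
    by (rule power_mono) (use norm_add_scalar_ge[OF assms(1), of "t/2"] assms(2) in \<open>auto simp: P_def\<close>)
  moreover have "(norm p + t/2)\<^sup>2 = (norm p)\<^sup>2 + t * norm p + t\<^sup>2/4"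
    by (simp add: power2_eq_square field_simps)
  ultimately show ?thesis by linarith
qed

text \<open>With \<open>b = y * cstar y\<close>, \<open>t = norm b\<close> and
  \<open>p = m * m\<close>, the element \<open>cstar y * (t - b) * y\<close> equals -(p^2 + t p).
  Its norm is at most \<open>t * norm p\<close>, since 0 <= t - b <= t; completing the square leaves
  no room for a nonzero \<open>p\<close>.\<close>

lemma neg_cstar_mult_imp_zero:
  fixes y m :: "'a::cstar_algebra_1"
  assumes sa: "cstar m = m" and neg: "cstar y * y = - (m * m)" and b: "pos (y * cstar y)"
  shows "m * m = 0"
proof -
  define b where "b = y * cstar y"
  define t where "t = norm b"
  define p where "p = m * m"
  have p: "pos p" unfolding p_def by (rule pos_square[OF sa])
  have ny: "(norm y)\<^sup>2 = norm p" using cstar_identity[of y] by (simp add: neg p_def)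
  have posb: "pos b" using b by (simp add: b_def)
  have "pos (t *\<^sub>R 1 - b)"
    by (rule pos_diff_of_norm_le[OF pos_selfadjoint[OF posb]]) (simp add: t_def)
  then have nb: "norm (t *\<^sub>R 1 - b) \<le> t"
    by (rule norm_le_of_pos) (use posb in simp)
  have "cstar y * (t *\<^sub>R 1 - b) * y = t *\<^sub>R (cstar y * y) - (cstar y * y) * (cstar y * y)"
    by (simp add: b_def algebra_simps mult.assoc)
  also have "\<dots> = - (p * p + t *\<^sub>R p)" by (simp add: neg p_def)
  finally have "norm (p * p + t *\<^sub>R p) = norm (cstar y * (t *\<^sub>R 1 - b) * y)"
    by (simp only: norm_minus_cancel)
  also have "\<dots> \<le> norm (cstar y) * norm (t *\<^sub>R 1 - b) * norm y"
    by (meson mult_right_mono norm_ge_zero norm_mult_ineq order_trans)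
  also have "\<dots> \<le> norm y * t * norm y"
    using nb by (simp add: mult_left_mono mult_right_mono)
  also have "\<dots> = t * norm p" by (simp add: ny[symmetric] power2_eq_square)
  finally have "norm (p * p + t *\<^sub>R p) \<le> t * norm p" .
  moreover have "(norm p)\<^sup>2 + t * norm p \<le> norm (p * p + t *\<^sub>R p)"
    by (rule norm_shifted_square_ge[OF p]) (simp add: t_def)
  ultimately have "(norm p)\<^sup>2 \<le> 0" by linarith
  then show ?thesis by (simp add: p_def)
qed

text \<open>Kaplansky's argument: if \<open>q\<close> is twice the negative part of \<open>h = x\<^sup>* x\<close> and \<open>y = x q\<close>, then
  \<open>- y\<^sup>* y\<close> and hence also \<open>y y\<^sup>*\<close> is positive, which forces \<open>y = 0\<close>.\<close>

theorem pos_cstar_mult: "pos (cstar x * (x::'a::cstar_algebra_1))"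
proof -
  define h where "h = cstar x * x"
  have sah: "cstar h = h" by (simp add: h_def cstar_mult cstar_cstar)
  \<comment> \<open>\<open>a\<close> plays the role of |h|; the commutation clause makes it commute
    with \<open>h\<close>.\<close>
  obtain a where a: "pos a" "a * a = h * h" "\<And>w. w * (h * h) = h * h * w \<Longrightarrow> w * a = a * w"
    using pos_sqrt[OF pos_square[OF sah]] by metis
  have ha: "h * a = a * h" by (rule a(3)) (simp add: mult.assoc)
  \<comment> \<open>The root of |h| is needed to write \<open>q * (a * q)\<close> as a square of a
    self-adjoint element.\<close>
  obtain c where c: "pos c" "c * c = a" "\<And>w. w * a = a * w \<Longrightarrow> w * c = c * w"
    using pos_sqrt[OF a(1)] by metis
  have hc: "h * c = c * h" by (rule c(3)[OF ha])
  have ac: "a * c = c * a" by (rule c(3)) simp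
  define q where "q = a - h"
  have saq: "cstar q = q" by (simp add: q_def cstar_diff sah pos_selfadjoint[OF a(1)])
  \<comment> \<open>That is, (h + a)(a - h) = a^2 - h^2 = 0.\<close>
  have hq: "h * q = - (a * q)"
    using a(2) ha by (simp add: q_def algebra_simps)
  have qc: "q * c = c * q" using hc ac by (simp add: q_def algebra_simps)
  define m where "m = c * q"
  have sam: "cstar m = m" by (simp add: m_def cstar_mult saq pos_selfadjoint[OF c(1)] qc)
  have mm: "m * m = q * (a * q)"
  proof -
    have "m * m = (q * c) * (c * q)" by (simp add: m_def qc)
    also have "\<dots> = q * (a * q)" by (simp add: mult.assoc flip: c(2))
    finally show ?thesis .
  qed
  define y where "y = x * q"
  have yy: "cstar y * y = - (m * m)"
  proof -
    have "cstar y * y = q * (h * q)" by (simp add: y_def h_def cstar_mult saq mult.assoc)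
    then show ?thesis by (simp add: hq mm)
  qed
  define r s where "r = cre y" and "s = cim y"
  have y: "y = r + scaleC \<i> s" by (simp add: r_def s_def cre_cim)
  have ys: "cstar y = r - scaleC \<i> s"
    by (simp add: y cstar_add cstar_scaleC scaleC_minus_left) (simp add: r_def s_def)
  \<comment> \<open>The mixed terms cancel in this sum, so \<open>y * cstar y\<close> becomes a sum
    of squares of self-adjoint elements.\<close>
  have "y * cstar y + cstar y * y = 2 *\<^sub>R (r * r) + 2 *\<^sub>R (s * s)"
    unfolding ys unfolding y
    by (simp add: algebra_simps mult_scaleC_left mult_scaleC_right scaleC_add_right
        scaleC_diff_right scaleR_2)
  then have "y * cstar y = 2 *\<^sub>R (r * r) + 2 *\<^sub>R (s * s) + m * m"
    using yy by (simp add: algebra_simps)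
  moreover have "pos (r * r)" "pos (s * s)" "pos (m * m)"
    by (auto intro!: pos_square sam simp: r_def s_def)
  ultimately have "pos (y * cstar y)" by (simp add: pos_add pos_scaleR)
  then have "m * m = 0" by (rule neg_cstar_mult_imp_zero[OF sam yy])
  then have "y = 0" using cstar_identity[of y] yy by simp
  then have "h * q = 0" by (simp add: h_def y_def mult.assoc)
  then have "q * q = 0" using hq by (simp add: q_def left_diff_distrib)
  then have "q = 0" using norm_square_selfadjoint[OF saq] by simp
  then show ?thesis using a(1) by (simp add: q_def h_def)
qed

lemma pos_conjugate:
  assumes "pos h" shows "pos (cstar w * h * w)"
proof -
  obtain k where k: "pos k" "k * k = h" using pos_sqrt[OF assms] by metis
  have "cstar w * h * w = cstar (k * w) * (k * w)"
    by (simp add: cstar_mult pos_selfadjoint[OF k(1)] mult.assoc flip: k(2))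
  then show ?thesis by (simp only: pos_cstar_mult)
qed

subsection \<open>Supporting functionals of sublinear functionals\<close>

definition sublinear :: "('a::real_vector \<Rightarrow> real) \<Rightarrow> bool" where
  "sublinear p \<longleftrightarrow> (\<forall>x y. p (x + y) \<le> p x + p y) \<and> (\<forall>r x. r \<ge> 0 \<longrightarrow> p (r *\<^sub>R x) = r * p x)"

lemma sublinear_add: "sublinear p \<Longrightarrow> p (x + y) \<le> p x + p y"
  by (simp add: sublinear_def)

lemma sublinear_scaleR: "sublinear p \<Longrightarrow> r \<ge> 0 \<Longrightarrow> p (r *\<^sub>R x) = r * p x"
  by (simp add: sublinear_def)

lemma sublinear_zero: "sublinear p \<Longrightarrow> p 0 = 0"
  using sublinear_scaleR[of p 0 0] by simp

lemma sublinear_minus: "sublinear p \<Longrightarrow> - p (- x) \<le> p x"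
  using sublinear_add[of p x "- x"] sublinear_zero[of p] by simp

text \<open>The scaling inequality for \<open>1/r\<close> is the reverse inequality for
  \<open>r\<close>.\<close>

lemma sublinearI:
  assumes add: "\<And>x y. p (x + y) \<le> p x + p y"
    and scale: "\<And>r x. r > 0 \<Longrightarrow> p (r *\<^sub>R x) \<le> r * p x" and zero: "p 0 = 0"
  shows "sublinear p"
  unfolding sublinear_def
proof (intro conjI allI impI)
  fix r :: real and x
  assume "r \<ge> 0"
  show "p (r *\<^sub>R x) = r * p x"
  proof (cases "r = 0")
    case False
    with \<open>r \<ge> 0\<close> have r: "r > 0" by simp
    have "p x \<le> (1/r) * p (r *\<^sub>R x)" using scale[of "1/r" "r *\<^sub>R x"] r by simp
    then have "r * p x \<le> p (r *\<^sub>R x)" using r by (simp add: field_simps)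
    with scale[OF r, of x] show ?thesis by simp
  qed (simp add: zero)
qed (rule add)

text \<open>\<open>q y\<close> is the infimum over t >= 0 of p(y + t x0) - t p(x0); the choice t = 1
  at \<open>- x0\<close> gives the last claim.\<close>

lemma sublinear_lower:
  fixes p :: "'a::real_vector \<Rightarrow> real"
  assumes p: "sublinear p"
  obtains q where "sublinear q" "\<And>x. q x \<le> p x" "q (- x0) \<le> - p x0"
proof -
  define g where "g y t = p (y + t *\<^sub>R x0) - t * p x0" for y t
  define q where "q y = (INF t\<in>{0..}. g y t)" for y
  \<comment> \<open>Subadditivity keeps the infimum finite.\<close>
  have lb: "- p (- y) \<le> g y t" if "t \<ge> 0" for y t
  proof -
    have "t * p x0 = p ((y + t *\<^sub>R x0) + (- y))"
      using sublinear_scaleR[OF p that] by simp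
    also have "\<dots> \<le> p (y + t *\<^sub>R x0) + p (- y)" by (rule sublinear_add[OF p])
    finally show ?thesis by (simp add: g_def)
  qed
  have bdd: "bdd_below (g y ` {0..})" for y
    by (rule bdd_belowI[of _ "- p (- y)"]) (use lb in auto)
  have q_le: "q y \<le> g y t" if "t \<ge> 0" for y t
    unfolding q_def by (rule cINF_lower[OF bdd]) (use that in simp)
  have q_ge: "c \<le> q y" if "\<And>t. t \<ge> 0 \<Longrightarrow> c \<le> g y t" for c y
    unfolding q_def by (rule cINF_greatest) (use that in auto)
  have le: "q x \<le> p x" for x using q_le[of 0 x] by (simp add: g_def)
  have "sublinear q"
  proof (rule sublinearI)
    fix x y
    have "q (x + y) - g x s \<le> q y" if s: "s \<ge> 0" for s
    proof (rule q_ge)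
      fix t :: real assume t: "t \<ge> 0"
      have "q (x + y) \<le> g (x + y) (s + t)" by (rule q_le) (use s t in simp)
      also have "\<dots> \<le> g x s + g y t"
        using sublinear_add[OF p, of "x + s *\<^sub>R x0" "y + t *\<^sub>R x0"]
        by (simp add: g_def algebra_simps)
      finally show "q (x + y) - g x s \<le> g y t" by simp
    qed
    then have "q (x + y) - q y \<le> q x" by (intro q_ge) (simp add: algebra_simps)
    then show "q (x + y) \<le> q x + q y" by simp
  next
    fix r :: real and x assume r: "r > 0"
    have "(1/r) * q (r *\<^sub>R x) \<le> q x"
    proof (rule q_ge)
      fix t :: real assume t: "t \<ge> 0"
      have "q (r *\<^sub>R x) \<le> g (r *\<^sub>R x) (r * t)" by (rule q_le) (use r t in simp)
      also have "\<dots> = r * g x t"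
        using sublinear_scaleR[OF p, of r "x + t *\<^sub>R x0"] r
        by (simp add: g_def algebra_simps)
      finally show "(1/r) * q (r *\<^sub>R x) \<le> g x t" using r by (simp add: field_simps)
    qed
    then show "q (r *\<^sub>R x) \<le> r * q x" using r by (simp add: field_simps)
  next
    have "0 \<le> q 0" by (rule q_ge) (use lb[of _ 0] sublinear_zero[OF p] in simp)
    then show "q 0 = 0" using le[of 0] sublinear_zero[OF p] by simp
  qed
  moreover have "q (- x0) \<le> - p x0"
    using q_le[of 1 "- x0"] sublinear_zero[OF p] by (simp add: g_def)
  ultimately show ?thesis using that le by blast
qed

text \<open>Zorn's lemma for the reversed pointwise order; a nonempty chain is bounded below by its
  pointwise infimum.\<close>

lemma minimal_sublinear_exists:
  fixes p :: "'a::real_vector \<Rightarrow> real"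
  assumes p: "sublinear p"
  obtains m where "sublinear m" "m \<le> p" "\<And>q. sublinear q \<Longrightarrow> q \<le> m \<Longrightarrow> q = m"
proof -
  define S where "S = {q. sublinear q \<and> q \<le> p}"
  have "\<exists>m\<in>S. \<forall>q\<in>S. q \<le> m \<longrightarrow> q = m"
  proof (rule predicate_Zorn[where P = "\<lambda>x y. y \<le> x"])
    show "partial_order_on S (relation_of (\<lambda>x y. y \<le> x) S)"
      by (rule partial_order_on_relation_ofI) auto
    fix C assume C: "C \<in> Chains (relation_of (\<lambda>x y. y \<le> x) S)"
    have CS: "sublinear q" "q \<le> p" if "q \<in> C" for q
      using C that by (auto simp: Chains_def relation_of_def S_def)
    have chain: "q \<le> r \<or> r \<le> q" if "q \<in> C" "r \<in> C" for q r
      using C that by (auto simp: Chains_def relation_of_def)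
    show "\<exists>u\<in>S. \<forall>a\<in>C. u \<le> a"
    proof (cases "C = {}")
      case True
      then show ?thesis using p by (auto simp: S_def)
    next
      case False
      define u where "u x = (INF q\<in>C. q x)" for x
      have lb: "- p (- x) \<le> q x" if "q \<in> C" for q x
        using sublinear_minus[OF CS(1)[OF that], of x] CS(2)[OF that] le_funD[of q p "- x"]
        by simp
      have bdd: "bdd_below ((\<lambda>q. q x) ` C)" for x
        by (rule bdd_belowI[of _ "- p (- x)"]) (use lb in auto)
      have u_le: "u x \<le> q x" if "q \<in> C" for q x
        unfolding u_def by (rule cINF_lower[OF bdd that])
      have u_ge: "c \<le> u x" if "\<And>q. q \<in> C \<Longrightarrow> c \<le> q x" for c x
        unfolding u_def by (rule cINF_greatest[OF False]) (use that in auto)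
      have "sublinear u"
      proof (rule sublinearI)
        fix x y
        have "u (x + y) - q x \<le> u y" if q: "q \<in> C" for q
        proof (rule u_ge)
          fix r assume r: "r \<in> C"
          \<comment> \<open>The smaller of the two chain members handles both arguments at once,
            which gives subadditivity of the infimum.\<close>
          obtain w where w: "w \<in> C" "w \<le> q" "w \<le> r" using chain[OF q r] q r by auto
          have "u (x + y) \<le> w x + w y"
            using u_le[OF w(1), of "x + y"] sublinear_add[OF CS(1)[OF w(1)], of x y] by simp
          also have "\<dots> \<le> q x + r y" using w by (simp add: add_mono le_funD)
          finally show "u (x + y) - q x \<le> r y" by simp
        qed
        then have "u (x + y) - u y \<le> u x" by (intro u_ge) (simp add: algebra_simps)
        then show "u (x + y) \<le> u x + u y" by simp
      next
        fix r :: real and x assume r: "r > 0"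
        have "(1/r) * u (r *\<^sub>R x) \<le> u x"
        proof (rule u_ge)
          fix q assume q: "q \<in> C"
          have "u (r *\<^sub>R x) \<le> r * q x"
            using u_le[OF q, of "r *\<^sub>R x"] sublinear_scaleR[OF CS(1)[OF q], of r x] r by simp
          then show "(1/r) * u (r *\<^sub>R x) \<le> q x" using r by (simp add: field_simps)
        qed
        then show "u (r *\<^sub>R x) \<le> r * u x" using r by (simp add: field_simps)
      next
        have z: "q 0 = 0" if "q \<in> C" for q using sublinear_zero[OF CS(1)[OF that]] .
        obtain q where "q \<in> C" using False by auto
        then have "u 0 \<le> 0" using u_le[of q 0] z[of q] by simp
        moreover have "0 \<le> u 0" by (rule u_ge) (simp add: z)
        ultimately show "u 0 = 0" by simp
      qed
      moreover have "u \<le> a" if "a \<in> C" for a using u_le[OF that] by (simp add: le_fun_def)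
      moreover have "u \<le> p"
        using False CS(2) \<open>\<And>a. a \<in> C \<Longrightarrow> u \<le> a\<close> by (meson all_not_in_conv order_trans)
      ultimately show ?thesis by (auto simp: S_def)
    qed
  qed
  then obtain m where m: "m \<in> S" "\<And>q. q \<in> S \<Longrightarrow> q \<le> m \<Longrightarrow> q = m" by blast
  show ?thesis
  proof (rule that)
    show "sublinear m" "m \<le> p" using m(1) by (auto simp: S_def)
    then show "q = m" if "sublinear q" "q \<le> m" for q
      using m(2)[of q] that by (auto simp: S_def)
  qed
qed

text \<open>Hahn--Banach: a minimal sublinear functional is odd by \<open>sublinear_lower\<close>, hence linear.\<close>

theorem sublinear_supporting_linear:
  fixes p :: "'a::real_vector \<Rightarrow> real"
  assumes p: "sublinear p"
  obtains f where "linear f" "\<And>x. f x \<le> p x" "f x0 = p x0"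
proof -
  \<comment> \<open>Lowering \<open>p\<close> at \<open>- x0\<close> before minimizing forces the
    support at \<open>x0\<close>: oddness turns \<open>f (- x0) \<le> - p x0\<close> into
    \<open>p x0 \<le> f x0\<close>.\<close>
  obtain p' where p': "sublinear p'" "\<And>x. p' x \<le> p x" "p' (- x0) \<le> - p x0"
    using sublinear_lower[OF p] by metis
  obtain f where f: "sublinear f" "f \<le> p'" "\<And>q. sublinear q \<Longrightarrow> q \<le> f \<Longrightarrow> q = f"
    using minimal_sublinear_exists[OF p'(1)] by metis
  have odd: "f (- x) = - f x" for x
  proof -
    obtain q where q: "sublinear q" "\<And>y. q y \<le> f y" "q (- x) \<le> - f x"
      using sublinear_lower[OF f(1)] by metis
    have "q = f" by (rule f(3)) (use q in \<open>auto simp: le_fun_def\<close>)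
    then show ?thesis using q(3) sublinear_minus[OF f(1), of x] by simp
  qed
  have "linear f"
  proof (rule linearI)
    fix x y
    show "f (x + y) = f x + f y"
      using sublinear_add[OF f(1), of x y] sublinear_add[OF f(1), of "- x" "- y"] odd[of "x + y"]
      by (simp add: odd)
  next
    fix r :: real and x
    show "f (r *\<^sub>R x) = r *\<^sub>R f x"
      using sublinear_scaleR[OF f(1), of r x] sublinear_scaleR[OF f(1), of "- r" x]
        odd[of "r *\<^sub>R x"] by (cases "r \<ge> 0") auto
  qed
  moreover have le: "f x \<le> p x" for x using f(2) p'(2)[of x] le_funD[of f p' x] by simp
  moreover have "f x0 = p x0"
    using le[of x0] odd[of x0] le_funD[OF f(2), of "- x0"] p'(3) by simp
  ultimately show ?thesis using that by blast
qed

subsection \<open>States and the numerical radius\<close>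

lemma cre_add: "cre (x + y) = cre x + cre (y::'a::cstar_algebra_1)"
  by (simp add: cre_def cstar_add algebra_simps)

lemma cre_scaleR: "cre (r *\<^sub>R x) = r *\<^sub>R cre (x::'a::cstar_algebra_1)"
  by (simp add: cre_def algebra_simps)

lemma cre_selfadjoint: "cstar h = h \<Longrightarrow> cre h = (h::'a::cstar_algebra_1)"
  by (simp add: cre_def flip: scaleR_2)

lemma cre_i_selfadjoint: "cstar h = h \<Longrightarrow> cre (scaleC \<i> h) = (0::'a::cstar_algebra_1)"
  by (simp add: cre_def cstar_scaleC scaleC_minus_left)

lemma cstar_cre_cim: "cstar x = cre x - scaleC \<i> (cim (x::'a::cstar_algebra_1))"
  by (subst (1) cre_cim[of x, symmetric])
     (simp only: cstar_add cstar_scaleC cstar_cre cstar_cim complex_cnj_i scaleC_minus_left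
        diff_conv_add_uminus)

text \<open>The least scalar dominating the real part of \<open>x\<close> in the order of the cone,
  that is, the maximum of \<open>Re (\<phi> x)\<close> over states. Passing through
  \<open>cre\<close> defines it on the whole algebra as a real vector space.\<close>

definition upper_bound :: "'a::cstar_algebra_1 \<Rightarrow> real" where
  "upper_bound x = Inf {t. pos (t *\<^sub>R 1 - cre x)}"

lemma upper_bound_le:
  fixes x :: "'a::cstar_algebra_1"
  assumes "pos (t *\<^sub>R 1 - cre x)" shows "upper_bound x \<le> t"
  unfolding upper_bound_def
proof (rule cInf_lower)
  show "bdd_below {t. pos (t *\<^sub>R 1 - cre x)}"
  proof (rule bdd_belowI)
    fix t assume "t \<in> {t. pos (t *\<^sub>R 1 - cre x)}"
    then have 1: "pos (t *\<^sub>R 1 - cre x)" by simp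
    have 2: "pos (norm (cre x) *\<^sub>R 1 - (- cre x))"
      by (rule pos_diff_of_norm_le) simp_all
    have "pos ((t + norm (cre x)) *\<^sub>R (1::'a))"
      using pos_add[OF 1 2] by (simp add: scaleR_add_left)
    then show "- norm (cre x) \<le> t" by simp
  qed
qed (use assms in simp)

text \<open>The infimum is attained because the cone is closed.\<close>

lemma pos_upper_bound: "pos (upper_bound x *\<^sub>R 1 - cre x)"
proof (rule pos_closed)
  fix e :: real assume e: "e > 0"
  have "norm (cre x) \<in> {t. pos (t *\<^sub>R 1 - cre x)}"
    using pos_diff_of_norm_le[of "cre x"] by simp
  then obtain t where t: "pos (t *\<^sub>R 1 - cre x)" "t < upper_bound x + e"
    using cInf_lessD[of "{t. pos (t *\<^sub>R 1 - cre x)}" "upper_bound x + e"] e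
    unfolding upper_bound_def by auto
  have "pos ((upper_bound x + e - t) *\<^sub>R 1 + (t *\<^sub>R 1 - cre x))"
    by (rule pos_add) (use t in simp_all)
  then show "pos (upper_bound x *\<^sub>R 1 - cre x + e *\<^sub>R 1)" by (simp add: algebra_simps)
qed

lemma sublinear_upper_bound: "sublinear (upper_bound :: 'a::cstar_algebra_1 \<Rightarrow> real)"
proof (rule sublinearI)
  fix x y :: 'a
  show "upper_bound (x + y) \<le> upper_bound x + upper_bound y"
    by (rule upper_bound_le)
       (use pos_add[OF pos_upper_bound[of x] pos_upper_bound[of y]] in
         \<open>simp add: cre_add algebra_simps\<close>)
next
  fix r :: real and x :: 'a assume r: "r > 0"
  show "upper_bound (r *\<^sub>R x) \<le> r * upper_bound x"
    by (rule upper_bound_le)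
       (use pos_scaleR[OF pos_upper_bound[of x], of r] r in \<open>simp add: cre_scaleR algebra_simps\<close>)
next
  have 1: "cre (0::'a) = 0" by (simp add: cre_selfadjoint)
  have "upper_bound (0::'a) \<le> 0" by (rule upper_bound_le) (simp add: 1)
  moreover have "upper_bound (0::'a) \<ge> 0" using pos_upper_bound[of "0::'a"] by (simp add: 1)
  ultimately show "upper_bound (0::'a) = 0" by simp
qed

text \<open>A real-linear \<open>f\<close> dominated by \<open>upper_bound\<close> and touching it
  at \<open>h\<close> is positive and unital, and vanishes on i times self-adjoint elements; its
  complexification is the state.\<close>

lemma cstate_upper_bound:
  fixes h :: "'a::cstar_algebra_1"
  obtains \<phi> where "cstate \<phi>" "Re (\<phi> h) = upper_bound h"
proof -
  obtain f where f: "linear f" "\<And>x. f x \<le> upper_bound x" "f h = upper_bound h"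
    using sublinear_supporting_linear[OF sublinear_upper_bound] by metis
  have add: "f (x + y) = f x + f y" for x y by (rule linear_add[OF f(1)])
  have scale: "f (r *\<^sub>R x) = r * f x" for r x using linear_scale[OF f(1), of r x] by simp
  have minus: "f (- x) = - f x" for x by (rule linear_neg[OF f(1)])
  have f_nonneg: "f x \<ge> 0" if "pos (cre x)" for x
  proof -
    have "cre (- x) = - cre x" using cre_scaleR[of "-1" x] by simp
    then have "upper_bound (- x) \<le> 0" using that by (intro upper_bound_le) simp
    then show ?thesis using f(2)[of "- x"] by (simp add: minus)
  qed
  have f_i: "f (scaleC \<i> x) = 0" if "cstar x = x" for x
  proof -
    \<comment> \<open>Both signs have real part 0, so \<open>f\<close> is nonnegative on
      both.\<close>
    have "cre (scaleC \<i> x) = 0" "cre (- scaleC \<i> x) = 0"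
      using cre_i_selfadjoint[OF that] cre_scaleR[of "-1" "scaleC \<i> x"] by simp_all
    then show ?thesis
      using f_nonneg[of "scaleC \<i> x"] f_nonneg[of "- scaleC \<i> x"] by (simp add: minus)
  qed
  have f1: "f 1 = 1"
  proof -
    have "upper_bound (1::'a) \<le> 1" by (rule upper_bound_le) (simp add: cre_selfadjoint)
    moreover have "upper_bound (- 1::'a) \<le> - 1" by (rule upper_bound_le) (simp add: cre_selfadjoint)
    ultimately show ?thesis using f(2)[of 1] f(2)[of "- 1"] by (simp add: minus)
  qed
  \<comment> \<open>The complex-linear functional f(x) - i f(i x) with real part
    \<open>f\<close>.\<close>
  define \<phi> where "\<phi> x = Complex (f x) (- f (scaleC \<i> x))" for x
  have "cstate \<phi>"
    unfolding cstate_def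
  proof (intro conjI allI)
    show "\<phi> (x + y) = \<phi> x + \<phi> y" for x y
      by (simp add: \<phi>_def add scaleC_add_right complex_eq_iff)
    show "\<phi> (scaleC c x) = c * \<phi> x" for c x
      by (simp add: \<phi>_def scaleC_eq[of c] add scale linear_diff[OF f(1)] scaleC_add_right scaleC_scaleR
          complex_eq_iff)
    show "Im (\<phi> (cstar x * x)) = 0" for x
      by (simp add: \<phi>_def f_i pos_selfadjoint[OF pos_cstar_mult])
    show "Re (\<phi> (cstar x * x)) \<ge> 0" for x
      by (simp add: \<phi>_def f_nonneg cre_selfadjoint pos_selfadjoint[OF pos_cstar_mult] pos_cstar_mult)
    show "\<phi> 1 = 1" by (simp add: \<phi>_def f1 f_i complex_eq_iff)
  qed
  then show ?thesis using that f(3) by (simp add: \<phi>_def)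
qed

lemma cstate_scaleR: "cstate \<phi> \<Longrightarrow> \<phi> (r *\<^sub>R x) = of_real r * \<phi> x"
  by (simp add: cstate_def scaleR_scaleC)

lemma cstate_add: "cstate \<phi> \<Longrightarrow> \<phi> (x + y) = \<phi> x + \<phi> y"
  by (simp add: cstate_def)

lemma cstate_diff: "cstate \<phi> \<Longrightarrow> \<phi> (x - y) = \<phi> x - \<phi> y"
  using cstate_add[of \<phi> "x - y" y] by simp

lemma cstate_pos:
  assumes "cstate \<phi>" "pos h" shows "Im (\<phi> h) = 0" "Re (\<phi> h) \<ge> 0"
proof -
  obtain k where k: "pos k" "k * k = h" using pos_sqrt[OF assms(2)] by metis
  then have "h = cstar k * k" by (simp add: pos_selfadjoint)
  then show "Im (\<phi> h) = 0" "Re (\<phi> h) \<ge> 0" using assms(1) by (simp_all add: cstate_def)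
qed

lemma cstate_selfadjoint:
  assumes \<phi>: "cstate \<phi>" and sa: "cstar h = h"
  shows "Im (\<phi> h) = 0" "\<bar>Re (\<phi> h)\<bar> \<le> norm h"
proof -
  have one: "\<phi> 1 = 1" using \<phi> by (simp add: cstate_def)
  have 1: "pos (norm h *\<^sub>R 1 - h)" by (rule pos_diff_of_norm_le[OF sa order_refl])
  have "pos (norm h *\<^sub>R 1 - (- h))" by (rule pos_diff_of_norm_le) (simp_all add: sa)
  then have 2: "pos (norm h *\<^sub>R 1 + h)" by simp
  show "Im (\<phi> h) = 0" "\<bar>Re (\<phi> h)\<bar> \<le> norm h"
    using cstate_pos[OF \<phi> 1] cstate_pos[OF \<phi> 2]
    by (simp_all add: cstate_diff[OF \<phi>] cstate_add[OF \<phi>] cstate_scaleR[OF \<phi>] one)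
qed

lemma cstate_cre_cim:
  assumes "cstate \<phi>"
  shows "Re (\<phi> x) = Re (\<phi> (cre x))" "Im (\<phi> x) = Re (\<phi> (cim x))"
proof -
  have "\<phi> x = \<phi> (cre x) + \<i> * \<phi> (cim x)"
    using assms cre_cim[of x] by (metis cstate_def)
  then show "Re (\<phi> x) = Re (\<phi> (cre x))" "Im (\<phi> x) = Re (\<phi> (cim x))"
    using cstate_selfadjoint(1)[OF assms cstar_cre, of x]
      cstate_selfadjoint(1)[OF assms cstar_cim, of x] by simp_all
qed

text \<open>The supremum needs an upper bound; the crude one from real and imaginary parts
  suffices.\<close>

lemma cmod_le_numerical_radius:
  fixes x :: "'a::cstar_algebra_1"
  assumes "cstate \<phi>" shows "cmod (\<phi> x) \<le> numerical_radius x"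
  unfolding numerical_radius_def
proof (rule cSup_upper)
  show "bdd_above {cmod (\<psi> x) | \<psi>. cstate \<psi>}"
  proof (rule bdd_aboveI, clarify)
    fix \<psi> :: "'a \<Rightarrow> complex" assume \<psi>: "cstate \<psi>"
    have "cmod (\<psi> x) \<le> \<bar>Re (\<psi> x)\<bar> + \<bar>Im (\<psi> x)\<bar>" by (rule cmod_le)
    also have "\<dots> \<le> norm (cre x) + norm (cim x)"
      unfolding cstate_cre_cim[OF \<psi>, of x] by (intro add_mono cstate_selfadjoint(2)[OF \<psi>]) simp_all
    finally show "cmod (\<psi> x) \<le> norm (cre x) + norm (cim x)" .
  qed
qed (use assms in auto)

lemma numerical_radius_le:
  fixes x :: "'a::cstar_algebra_1"
  assumes "\<And>\<phi>. cstate \<phi> \<Longrightarrow> cmod (\<phi> x) \<le> c" shows "numerical_radius x \<le> c"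
  unfolding numerical_radius_def
proof (rule cSup_least)
  obtain \<phi> :: "'a \<Rightarrow> complex" where "cstate \<phi>" using cstate_upper_bound by metis
  then show "{cmod (\<phi> x) | \<phi>. cstate \<phi>} \<noteq> {}" by blast
qed (use assms in auto)

text \<open>For the lower estimate, states attaining \<open>upper_bound\<close> at \<open>h\<close>
  and at \<open>- h\<close> make both \<open>?s - h\<close> and \<open>?s + h\<close>
  positive.\<close>

lemma numerical_radius_selfadjoint:
  fixes h :: "'a::cstar_algebra_1"
  assumes sa: "cstar h = h" shows "numerical_radius h = norm h"
proof (rule antisym)
  show "numerical_radius h \<le> norm h"
    by (rule numerical_radius_le)
       (use cstate_selfadjoint[OF _ sa] in \<open>simp add: cmod_eq_Re\<close>)
  have le: "upper_bound x \<le> numerical_radius x" for x :: 'a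
  proof -
    obtain \<phi> where \<phi>: "cstate \<phi>" "Re (\<phi> x) = upper_bound x" using cstate_upper_bound by metis
    then show ?thesis
      using cmod_le_numerical_radius[OF \<phi>(1), of x] complex_Re_le_cmod[of "\<phi> x"] by simp
  qed
  have neg: "numerical_radius (- h) \<le> numerical_radius h"
    by (rule numerical_radius_le)
       (use cmod_le_numerical_radius[of _ h] cstate_scaleR[of _ "-1" h] in fastforce)
  let ?s = "numerical_radius h"
  have up: "pos (?s *\<^sub>R 1 - x)" if "cstar x = x" "upper_bound x \<le> ?s" for x :: 'a
  proof -
    have "pos ((?s - upper_bound x) *\<^sub>R 1 + (upper_bound x *\<^sub>R 1 - cre x))"
      by (rule pos_add[OF _ pos_upper_bound]) (use that in simp)
    then show ?thesis by (simp add: cre_selfadjoint[OF that(1)] algebra_simps)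
  qed
  show "norm h \<le> ?s"
    by (rule norm_le_of_pos_diff_add) (use up[of h] up[of "- h"] sa le[of h] le[of "- h"] neg in auto)
qed

subsection \<open>Positive unital maps\<close>

lemma clinear_map_add: "clinear_map T \<Longrightarrow> T (x + y) = T x + T y"
  by (simp add: clinear_map_def)

lemma clinear_map_scaleC: "clinear_map T \<Longrightarrow> T (scaleC c x) = scaleC c (T x)"
  by (simp add: clinear_map_def)

lemma clinear_map_linear: "clinear_map T \<Longrightarrow> linear T"
  by (rule linearI) (simp_all add: clinear_map_def scaleR_scaleC)

text \<open>For a state \<open>\<phi>\<close> and \<open>\<beta> = Im \<phi>(T h)\<close> one has \<open>(\<beta> + t)\<^sup>2 \<le> \<parallel>h\<parallel>\<^sup>2 + t\<^sup>2\<close> for all real \<open>t\<close>,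
  by comparing the numerical radii of \<open>h + i t\<close> and of its image; hence \<open>\<beta> = 0\<close>.\<close>

lemma numerical_radius_contraction_selfadjoint:
  fixes T :: "'a::cstar_algebra_1 \<Rightarrow> 'b::cstar_algebra_1"
  assumes T: "clinear_map T" and one: "T 1 = 1"
    and nr: "\<And>x. numerical_radius (T x) \<le> numerical_radius x"
    and sa: "cstar h = h"
  shows "cstar (T h) = T h"
proof -
  have Im0: "Im (\<phi> (T h)) = 0" if \<phi>: "cstate \<phi>" for \<phi>
  proof (rule ccontr)
    define \<beta> where "\<beta> = Im (\<phi> (T h))"
    assume "Im (\<phi> (T h)) \<noteq> 0"
    then have b: "\<beta> \<noteq> 0" by (simp add: \<beta>_def)
    \<comment> \<open>Chosen so that 2 \<beta> t exceeds \<open>norm h\<close> squared by 1, which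
      contradicts the inequality.\<close>
    define t where "t = ((norm h)\<^sup>2 + 1) / (2 * \<beta>)"
    define z where "z = h + scaleC (\<i> * of_real t) 1"
    have "numerical_radius z \<le> sqrt ((norm h)\<^sup>2 + t\<^sup>2)"
    proof (rule numerical_radius_le)
      fix \<psi> :: "'a \<Rightarrow> complex" assume \<psi>: "cstate \<psi>"
      have "\<psi> z = \<psi> h + \<i> * of_real t" using \<psi> by (simp add: z_def cstate_def)
      then have "cmod (\<psi> z) = sqrt ((Re (\<psi> h))\<^sup>2 + t\<^sup>2)"
        using cstate_selfadjoint(1)[OF \<psi> sa] by (simp add: cmod_def)
      moreover have "(Re (\<psi> h))\<^sup>2 \<le> (norm h)\<^sup>2"
        using cstate_selfadjoint(2)[OF \<psi> sa] by (simp add: abs_le_square_iff[symmetric])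
      ultimately show "cmod (\<psi> z) \<le> sqrt ((norm h)\<^sup>2 + t\<^sup>2)" by simp
    qed
    moreover have "\<bar>\<beta> + t\<bar> \<le> numerical_radius (T z)"
    proof -
      have "T z = T h + scaleC (\<i> * of_real t) 1"
        by (simp add: z_def clinear_map_add[OF T] clinear_map_scaleC[OF T] one)
      then have "\<phi> (T z) = \<phi> (T h) + \<i> * of_real t" using \<phi> by (simp add: cstate_def)
      then have "\<bar>\<beta> + t\<bar> \<le> cmod (\<phi> (T z))"
        using abs_Im_le_cmod[of "\<phi> (T z)"] by (simp add: \<beta>_def)
      then show ?thesis using cmod_le_numerical_radius[OF \<phi>, of "T z"] by simp
    qed
    ultimately have "\<bar>\<beta> + t\<bar> \<le> sqrt ((norm h)\<^sup>2 + t\<^sup>2)" using nr[of z] by linarith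
    then have "(\<beta> + t)\<^sup>2 \<le> (norm h)\<^sup>2 + t\<^sup>2" by (rule sqrt_ge_absD)
    moreover have "2 * \<beta> * t = (norm h)\<^sup>2 + 1" using b by (simp add: t_def)
    ultimately have "\<beta>\<^sup>2 + 1 \<le> 0" by (simp add: power2_sum)
    moreover have "\<beta>\<^sup>2 \<ge> 0" by simp
    ultimately show False by linarith
  qed
  have "numerical_radius (cim (T h)) \<le> 0"
  proof (rule numerical_radius_le)
    fix \<phi> :: "'b \<Rightarrow> complex" assume \<phi>: "cstate \<phi>"
    show "cmod (\<phi> (cim (T h))) \<le> 0"
      using Im0[OF \<phi>] cstate_cre_cim(2)[OF \<phi>, of "T h"]
        cstate_selfadjoint(1)[OF \<phi> cstar_cim, of "T h"] by (simp add: cmod_def)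
  qed
  then have "cim (T h) = 0" by (simp add: numerical_radius_selfadjoint)
  then show ?thesis using cre_cim[of "T h"] cstar_cre_cim[of "T h"] by simp
qed

text \<open>The expression is \<open>\<Sum>\<^sub>i (l + i - c) T (W B\<^sub>i) (l + i - c)\<close> for the Bernstein polynomials
  \<open>B\<^sub>i = (n choose i) h\<^sup>i (1 - h)\<^sup>n\<^sup>-\<^sup>i\<close>, expanded by means of their first two moments;
  the induction is Pascal's rule for the \<open>B\<^sub>i\<close>.\<close>

lemma pos_bernstein_moments:
  fixes T :: "'a::cstar_algebra_1 \<Rightarrow> 'b::cstar_algebra_1"
  assumes T: "linear T" and pos_T: "\<And>x. pos x \<Longrightarrow> pos (T x)"
    and h: "pos h" "pos (1 - h)" and c: "cstar c = c"
    and W: "pos W" "W * h = h * W"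
  shows "pos (T (W * (l\<^sup>2 *\<^sub>R 1 + (2 * l * n + n) *\<^sub>R h + (real n * (real n - 1)) *\<^sub>R (h * h)))
      - c * T (W * (l *\<^sub>R 1 + real n *\<^sub>R h)) - T (W * (l *\<^sub>R 1 + real n *\<^sub>R h)) * c + c * T W * c)"
  using W
proof (induction n arbitrary: W l)
  case 0
  have "pos (cstar (l *\<^sub>R 1 - c) * T W * (l *\<^sub>R 1 - c))"
    by (rule pos_conjugate[OF pos_T[OF 0(1)]])
  then show ?case
    by (simp add: cstar_diff c linear_scale[OF T] algebra_simps power2_eq_square)
next
  case (Suc n)
  \<comment> \<open>\<open>E n l\<close> and \<open>M n l\<close> are the second and first moments
    of l + i under the weights B_i.\<close>
  define E where "E n l = l\<^sup>2 *\<^sub>R 1 + (2 * l * n + n) *\<^sub>R h + (n * (n - 1)) *\<^sub>R (h * h)" for n l :: real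
  define M where "M n l = l *\<^sub>R 1 + n *\<^sub>R h" for n l :: real
  have E: "(1 - h) * E n l + h * E n (l + 1) = E (1 + n) l" for n l
    by (simp add: E_def algebra_simps power2_eq_square) (simp flip: scaleR_add_left)
  have M: "(1 - h) * M n l + h * M n (l + 1) = M (1 + n) l" for n l
    by (simp add: M_def algebra_simps)
  \<comment> \<open>Pascal's rule splits the weight: the part with \<open>1 - h\<close> keeps
    \<open>l\<close>, the part with \<open>h\<close> shifts it to \<open>l + 1\<close>.\<close>
  let ?P = "W * (1 - h)" and ?Q = "W * h"
  have "pos ?P" by (rule pos_mult) (use Suc.prems h in \<open>auto simp: algebra_simps\<close>)
  moreover have "?P * h = h * ?P" using Suc.prems(2) by (simp add: algebra_simps)
  ultimately have 1: "pos (T (?P * E n l) - c * T (?P * M n l) - T (?P * M n l) * c + c * T ?P * c)"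
    unfolding E_def M_def by (rule Suc.IH)
  have "pos ?Q" by (rule pos_mult) (use Suc.prems h in auto)
  moreover have "?Q * h = h * ?Q" using Suc.prems(2) by (simp add: mult.assoc)
  ultimately have 2: "pos (T (?Q * E n (l + 1)) - c * T (?Q * M n (l + 1)) - T (?Q * M n (l + 1)) * c
      + c * T ?Q * c)"
    unfolding E_def M_def by (rule Suc.IH)
  have TE: "T (W * E (1 + n) l) = T (?P * E n l) + T (?Q * E n (l + 1))"
    by (simp add: linear_add[OF T, symmetric] mult.assoc distrib_left[symmetric] E)
  have TM: "T (W * M (1 + n) l) = T (?P * M n l) + T (?Q * M n (l + 1))"
    by (simp add: linear_add[OF T, symmetric] mult.assoc distrib_left[symmetric] M)
  have TW: "T W = T ?P + T ?Q"
    by (simp add: linear_add[OF T, symmetric] distrib_left[symmetric])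
  have "pos (T (W * E (1 + n) l) - c * T (W * M (1 + n) l) - T (W * M (1 + n) l) * c + c * T W * c)"
    using pos_add[OF 1 2] unfolding TE TM TW by (simp add: algebra_simps)
  then show ?case by (simp add: E_def M_def)
qed

text \<open>The moment expression with l = 0, W = 1 and c = n T(k) equals n^2 (T(k^2) - T(k)^2) + n
  D. After division by n^2 the error D/n tends to 0, and the cone is closed.\<close>

lemma kadison_inequality_unit:
  fixes T :: "'a::cstar_algebra_1 \<Rightarrow> 'b::cstar_algebra_1"
  assumes T: "linear T" and pos_T: "\<And>x. pos x \<Longrightarrow> pos (T x)" and one: "T 1 = 1"
    and k: "pos k" "pos (1 - k)"
  shows "pos (T (k * k) - T k * T k)"
proof (rule pos_closed)
  fix e :: real assume e: "e > 0"
  define D where "D = T (k - k * k)"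
  have D: "cstar D = D"
  proof -
    have "pos (k * (1 - k))" by (rule pos_mult[OF k]) (simp add: algebra_simps)
    then show ?thesis by (simp add: D_def algebra_simps pos_T pos_selfadjoint)
  qed
  obtain n :: nat where n: "norm D / e < real n" using reals_Archimedean2 by blast
  have "0 \<le> norm D / e" using e by simp
  with n have n0: "n > 0" by linarith
  have Tk: "cstar (T k) = T k" by (rule pos_selfadjoint[OF pos_T[OF k(1)]])
  have "cstar (real n *\<^sub>R T k) = real n *\<^sub>R T k" by (simp add: Tk)
  from pos_bernstein_moments[OF T pos_T k this pos_one, of 0 n]
  have "pos (n\<^sup>2 *\<^sub>R (T (k * k) - T k * T k) + n *\<^sub>R D)"
    by (simp add: D_def one linear_add[OF T] linear_diff[OF T] linear_scale[OF T] algebra_simps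
        power2_eq_square)
  then have "pos ((1 / n\<^sup>2) *\<^sub>R (n\<^sup>2 *\<^sub>R (T (k * k) - T k * T k) + n *\<^sub>R D))"
    by (rule pos_scaleR) simp
  then have 1: "pos (T (k * k) - T k * T k + (1 / n) *\<^sub>R D)"
    using n0 by (simp add: scaleR_add_right power2_eq_square)
  have "norm ((1 / n) *\<^sub>R D) \<le> e" using n n0 e by (simp add: field_simps)
  then have 2: "pos (e *\<^sub>R 1 - (1 / n) *\<^sub>R D)" by (intro pos_diff_of_norm_le) (simp_all add: D)
  show "pos (T (k * k) - T k * T k + e *\<^sub>R 1)"
    using pos_add[OF 1 2] by (simp add: algebra_simps)
qed

theorem kadison_inequality:
  fixes T :: "'a::cstar_algebra_1 \<Rightarrow> 'b::cstar_algebra_1"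
  assumes T: "linear T" and pos_T: "\<And>x. pos x \<Longrightarrow> pos (T x)" and one: "T 1 = 1"
    and sa: "cstar h = h"
  shows "pos (T (h * h) - T h * T h)"
proof -
  \<comment> \<open>The added 1 keeps \<open>s\<close> positive for \<open>h = 0\<close>. The
    element \<open>k = 1/2 + h/(2s)\<close> lies between 0 and 1, and the defect T(k^2) - T(k)^2
    ignores the shift and scales by r^2.\<close>
  define s where "s = norm h + 1"
  have s: "s > 0" "norm h \<le> s" by (auto simp: s_def add_nonneg_pos)
  define r where "r = 1 / (2 * s)"
  have r: "r > 0" using s by (simp add: r_def)
  define k where "k = (1/2) *\<^sub>R 1 + r *\<^sub>R h"
  have "pos (r *\<^sub>R (s *\<^sub>R 1 - (- h)))"
    by (intro pos_scaleR pos_diff_of_norm_le) (use sa s r in auto)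
  then have k1: "pos k" using s by (simp add: k_def r_def scaleR_add_right)
  have "pos (r *\<^sub>R (s *\<^sub>R 1 - h))"
    by (intro pos_scaleR pos_diff_of_norm_le) (use sa s r in auto)
  moreover have "1 - k = r *\<^sub>R (s *\<^sub>R 1 - h)"
  proof -
    have "1 - k = (1 - 1/2) *\<^sub>R 1 - r *\<^sub>R h" unfolding k_def scaleR_diff_left by simp
    then show ?thesis using s by (simp add: r_def scaleR_diff_right)
  qed
  ultimately have k2: "pos (1 - k)" by simp
  have "T (k * k) - T k * T k = r\<^sup>2 *\<^sub>R (T (h * h) - T h * T h)"
    by (simp add: k_def one linear_add[OF T] linear_scale[OF T] algebra_simps power2_eq_square)
  then have "pos (r\<^sup>2 *\<^sub>R (T (h * h) - T h * T h))"
    using kadison_inequality_unit[OF T pos_T one k1 k2] by simp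
  then have "pos ((1 / r\<^sup>2) *\<^sub>R (r\<^sup>2 *\<^sub>R (T (h * h) - T h * T h)))"
    by (rule pos_scaleR) simp
  then show ?thesis using r by simp
qed

text \<open>Squaring \<open>h + k\<close> polarizes the square identity on self-adjoint elements;
  complex bilinearity of x y + y x carries it to all elements.\<close>

lemma jordan_star_isoI:
  fixes T :: "'a::cstar_algebra_1 \<Rightarrow> 'b::cstar_algebra_1"
  assumes T: "clinear_map T" and "bij T"
    and T_sa: "\<And>h. cstar h = h \<Longrightarrow> cstar (T h) = T h"
    and sq: "\<And>h. cstar h = h \<Longrightarrow> T (h * h) = T h * T h"
  shows "jordan_star_iso T"
proof -
  note lin = clinear_map_linear[OF T]
  note T_simps = linear_add[OF lin] linear_diff[OF lin] clinear_map_scaleC[OF T]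
  have star: "T (cstar x) = cstar (T x)" for x
  proof -
    have "cstar (T x) = cstar (T (cre x + scaleC \<i> (cim x)))" by (simp only: cre_cim)
    also have "\<dots> = T (cre x) - scaleC \<i> (T (cim x))"
      by (simp add: T_simps cstar_add cstar_scaleC T_sa scaleC_minus_left)
    also have "\<dots> = T (cstar x)" by (simp add: cstar_cre_cim T_simps)
    finally show ?thesis by simp
  qed
  have polar: "T (h * k + k * h) = T h * T k + T k * T h" if "cstar h = h" "cstar k = k" for h k
  proof -
    have "T h * T h + T (h * k + k * h) + T k * T k = T (h * h) + T (h * k + k * h) + T (k * k)"
      by (simp add: sq that)
    also have "\<dots> = T ((h + k) * (h + k))"
      by (simp add: distrib_left distrib_right linear_add[OF lin])
    also have "\<dots> = (T h + T k) * (T h + T k)"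
      by (simp add: sq cstar_add that linear_add[OF lin])
    finally show ?thesis by (simp add: distrib_left distrib_right)
  qed
  \<comment> \<open>Stated over a fresh type, as it expands products both in the domain and in the
    range.\<close>
  have bilin: "(a + scaleC \<i> b) * (c + scaleC \<i> d) + (c + scaleC \<i> d) * (a + scaleC \<i> b)
      = (a * c + c * a) + scaleC \<i> (a * d + d * a) + scaleC \<i> (b * c + c * b) - (b * d + d * b)"
    for a b c d :: "'c::cstar_algebra_1"
    by (simp add: algebra_simps mult_scaleC_left mult_scaleC_right scaleC_add_right)
  have J: "T (x * y + y * x) = T x * T y + T y * T x" for x y
  proof -
    let ?a = "cre x" and ?b = "cim x" and ?c = "cre y" and ?d = "cim y"
    have "T (x * y + y * x)
      = T ((?a + scaleC \<i> ?b) * (?c + scaleC \<i> ?d) + (?c + scaleC \<i> ?d) * (?a + scaleC \<i> ?b))"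
      by (simp only: cre_cim)
    also have "\<dots> = T (?a * ?c + ?c * ?a) + scaleC \<i> (T (?a * ?d + ?d * ?a))
        + scaleC \<i> (T (?b * ?c + ?c * ?b)) - T (?b * ?d + ?d * ?b)"
      unfolding bilin by (simp only: T_simps)
    also have "\<dots> = (T ?a + scaleC \<i> (T ?b)) * (T ?c + scaleC \<i> (T ?d))
        + (T ?c + scaleC \<i> (T ?d)) * (T ?a + scaleC \<i> (T ?b))"
      unfolding bilin by (simp only: polar cstar_cre cstar_cim)
    also have "\<dots> = T (?a + scaleC \<i> ?b) * T (?c + scaleC \<i> ?d)
        + T (?c + scaleC \<i> ?d) * T (?a + scaleC \<i> ?b)"
      by (simp only: T_simps)
    finally show ?thesis by (simp only: cre_cim)
  qed
  show ?thesis
    unfolding jordan_star_iso_def jordan_prod_def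
    using assms(1,2) star by (simp add: clinear_map_scaleC[OF T] J)
qed

theorem theorem5p1:
  fixes T :: "'a::cstar_algebra_1 \<Rightarrow> 'b::cstar_algebra_1"
  assumes "clinear_map T"
    and "surj T"
    and "T 1 = 1"
    and "\<And>x. numerical_radius (T x) = numerical_radius x"
  shows "jordan_star_iso T"
proof -
  note T = assms(1) and one = assms(3)
  note lin = clinear_map_linear[OF T]
  have T_sa: "cstar (T h) = T h" if "cstar h = h" for h
    by (rule numerical_radius_contraction_selfadjoint[OF T one _ that]) (simp add: assms(4))
  have iso: "norm (T h) = norm h" if "cstar h = h" for h
    using assms(4)[of h] by (simp add: numerical_radius_selfadjoint T_sa that)
  have sa_T: "cstar x = x" if "cstar (T x) = T x" for x
  proof -
    have "T x = T (cre x + scaleC \<i> (cim x))" by (simp only: cre_cim)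
    then have Tx: "T x = T (cre x) + scaleC \<i> (T (cim x))"
      by (simp only: clinear_map_add[OF T] clinear_map_scaleC[OF T])
    then have "cstar (T x) = T (cre x) - scaleC \<i> (T (cim x))"
      by (simp add: cstar_add cstar_scaleC T_sa scaleC_minus_left)
    \<comment> \<open>Comparing \<open>T x\<close> with its adjoint kills the image of
      \<open>cim x\<close>; the isometry on self-adjoint elements then gives
      \<open>cim x = 0\<close>.\<close>
    with that Tx have "2 *\<^sub>R scaleC \<i> (T (cim x)) = 0" by (simp add: scaleR_2 algebra_simps)
    then have "norm (T (cim x)) = 0" using norm_scaleC[of \<i> "T (cim x)"] by simp
    then have "cim x = 0" using iso[of "cim x"] by simp
    then show ?thesis using cre_cim[of x] cstar_cre_cim[of x] by simp
  qed
  have "inj T"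
    unfolding linear_injective_0[OF lin]
  proof (intro allI impI)
    fix x assume "T x = 0"
    \<comment> \<open>0 is self-adjoint, hence so is \<open>x\<close>, and \<open>T\<close> is
      isometric there.\<close>
    then show "x = 0" using sa_T[of x] iso[of x] by simp
  qed
  then have bij: "bij T" using assms(2) by (simp add: bij_def)
  have norm_T: "norm (t *\<^sub>R 1 - T h) = norm (t *\<^sub>R 1 - h)" if "cstar h = h" for t h
    using iso[of "t *\<^sub>R 1 - h"] that
    by (simp add: cstar_diff linear_diff[OF lin] linear_scale[OF lin] one)
  have pos_T: "pos (T h) \<longleftrightarrow> pos h" for h
  proof -
    have "cstar (T h) = T h \<longleftrightarrow> cstar h = h" using T_sa sa_T by blast
    then show ?thesis unfolding pos_def using norm_T[of h] by (simp cong: conj_cong)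
  qed
  define S where "S = inv T"
  have TS: "T (S y) = y" for y by (simp add: S_def surj_f_inv_f[OF assms(2)])
  have ST: "S (T x) = x" for x by (simp add: S_def inv_f_f[OF \<open>inj T\<close>])
  have linS: "linear S"
    by (rule linearI)
       (metis ST TS linear_add[OF lin], metis ST TS linear_scale[OF lin])
  have pos_S: "pos (S y)" if "pos y" for y using that pos_T[of "S y"] by (simp add: TS)
  have sq: "T (h * h) = T h * T h" if sa: "cstar h = h" for h
  proof -
    have "S 1 = 1" using ST[of 1] one by simp
    \<comment> \<open>Kadison's inequality for the inverse at \<open>T h\<close>; applying
      \<open>T\<close> to it reverses the inequality for \<open>T\<close> at
      \<open>h\<close>.\<close>
    then have "pos (S (T h * T h) - S (T h) * S (T h))"
      by (rule kadison_inequality[OF linS pos_S _ T_sa[OF sa], rotated])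
    then have "pos (T (S (T h * T h) - h * h))" by (simp add: ST pos_T)
    \<comment> \<open>The scalar 0 puts both signs in the form of the two-sided norm estimate, which
      yields norm at most 0.\<close>
    then have 1: "pos (0 *\<^sub>R 1 - (T (h * h) - T h * T h))" by (simp add: linear_diff[OF lin] TS)
    have 2: "pos (0 *\<^sub>R 1 + (T (h * h) - T h * T h))"
      using kadison_inequality[OF lin _ one sa] pos_T by simp
    show ?thesis using norm_le_of_pos_diff_add[OF 1 2] by simp
  qed
  show ?thesis by (rule jordan_star_isoI[OF T bij]) (rule T_sa sq, assumption)+
qed

end
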